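(* Let $G_n$ be a graph of order $n$ with Laplacian matrix $L(G_n)$, and let $p\ge 2$. Let $K_{1, p-1}\circ_{1}(G_{n}\vee K_1)$ be the graph obtained from the star $K_{1,p-1}$ and the join $G_n\vee K_1$ by identifying the center of $K_{1,p-1}$ with the vertex of $K_1$; call the identified vertex $u^{*}$. Write $M=(L(G_n)+I_n)^{-1}$, with rows and columns indexed by $V(G_n)$. Then the resistance distances $r_{ij}$ in this graph are: (i) for $v_i=u^{*}$, $v_j\in V(K_{1,p-1})\setminus \{u^{*}\}$, $r_{ij}= 1$; (ii) for $v_i= u^{*}$, $v_j\in V(G_n)$, $r_{ij}= M_{jj}$; (iii) for distinct $v_i, v_j\in V(K_{1,p-1})\setminus \{u^{*}\}$, $r_{ij}= 2$; (iv) for $v_i\in V(K_{1,p-1})\setminus \{u^{*}\}$, $v_j\in V(G_n)$, $r_{ij}= 1+M_{jj}$; (v) for distinct $v_i, v_j\in V(G_n)$, $r_{ij}= M_{ii}+M_{jj}-2M_{ij}$.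
   Context: The join $G\vee H$ of disjoint graphs $G,H$ is obtained from $G\cup H$ by adding all edges between $V(G)$ and $V(H)$. The Laplacian of a graph is $L=D-A$. The resistance distance $r_{ij}$ between vertices of a connected graph is the effective resistance between them when every edge is a resistor of $1\Omega$; equivalently $r_{ij}=l^{\#}_{ii}+l^{\#}_{jj}-2l^{\#}_{ij}$ with $L^{\#}$ the group inverse of the Laplacian. *)

theory Defs
  imports "Graph_Theory.Graph_Theory"
begin

section \<open>Graphs\<close>

text \<open>
  Finite simple graphs are the \<open>pair_graph\<close>s of the entry \<open>Graph_Theory\<close>: a finite
  vertex set with a symmetric, loop-free set of arcs, an edge being represented by its two
  orientations.
\<close>

definition star_graph :: "nat \<Rightarrow> nat pair_pre_digraph" where
  "star_graph p = \<lparr> pverts = {..<p}, parcs = {0} \<times> {1..<p} \<union> {1..<p} \<times> {0} \<rparr>"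

definition K1 :: "unit pair_pre_digraph" where
  "K1 = \<lparr> pverts = {()}, parcs = {} \<rparr>"

text \<open>The two graphs are made disjoint by taking the disjoint sum of the vertex sets.\<close>

definition graph_join ::
    "'a pair_pre_digraph \<Rightarrow> 'b pair_pre_digraph \<Rightarrow> ('a + 'b) pair_pre_digraph" where
  "graph_join G H =
     \<lparr> pverts = Inl ` pverts G \<union> Inr ` pverts H,
       parcs = map_prod Inl Inl ` parcs G \<union> map_prod Inr Inr ` parcs H
         \<union> (Inl ` pverts G) \<times> (Inr ` pverts H) \<union> (Inr ` pverts H) \<times> (Inl ` pverts G) \<rparr>"

text \<open>
  Identification of the vertex \<open>u\<close> of \<open>G\<close> with the vertex \<open>v\<close> of \<open>H\<close>: every vertex of \<open>H\<close>
  other than \<open>v\<close> is kept as a separate vertex \<open>Inr w\<close>, while \<open>v\<close> becomes \<open>Inl u\<close>.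
\<close>

definition glue_map :: "'a \<Rightarrow> 'b \<Rightarrow> 'b \<Rightarrow> 'a + 'b" where
  "glue_map u v w = (if w = v then Inl u else Inr w)"

definition coalescence ::
    "'a pair_pre_digraph \<Rightarrow> 'a \<Rightarrow> 'b pair_pre_digraph \<Rightarrow> 'b \<Rightarrow> ('a + 'b) pair_pre_digraph" where
  "coalescence G u H v =
     \<lparr> pverts = Inl ` pverts G \<union> glue_map u v ` pverts H,
       parcs = map_prod Inl Inl ` parcs G
         \<union> map_prod (glue_map u v) (glue_map u v) ` parcs H \<rparr>"

lemma pair_graphI_simple:
  assumes "finite (pverts G)" "parcs G \<subseteq> pverts G \<times> pverts G"
    "sym (parcs G)" "irrefl (parcs G)"
  shows "pair_graph G"
proof -
  have "finite (parcs G)"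
    using assms(1,2) by (meson finite_SigmaI finite_subset)
  then show ?thesis
    using assms by unfold_locales (auto simp: symmetric_def irrefl_def)
qed

lemma complete_bipartite_star_graph:
  assumes "p \<ge> 1"
  shows "K\<^bsub>1,p - 1\<^esub> (with_proj (star_graph p))"
proof -
  have g: "pair_graph (star_graph p)"
    using assms by (intro pair_graphI_simple)
      (auto simp: star_graph_def sym_def irrefl_def)
  show ?thesis
    unfolding complete_bipartite_digraph_pair_def
    using g assms
    by (intro conjI exI[of _ "{0}"] exI[of _ "{1..<p}"])
      (auto simp: star_graph_def)
qed

lemma complete_K1: "K\<^bsub>1\<^esub> (with_proj K1)"
  unfolding complete_digraph_pair_def
  by (auto simp: K1_def intro!: pair_graphI_simple)


section \<open>Matrices indexed by a finite set\<close>

text \<open>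
  A matrix with rows and columns indexed by \<open>V\<close> is a function of two arguments of which only
  the values on \<open>V \<times> V\<close> are relevant. Inverses are normalised to vanish outside \<open>V \<times> V\<close>, so
  that they are unique as functions.
\<close>

type_synonym 'a matr = "'a \<Rightarrow> 'a \<Rightarrow> real"

definition mat_supp :: "'a set \<Rightarrow> 'a matr \<Rightarrow> bool" where
  "mat_supp V A \<longleftrightarrow> (\<forall>i j. i \<notin> V \<or> j \<notin> V \<longrightarrow> A i j = 0)"

definition mat_eq :: "'a set \<Rightarrow> 'a matr \<Rightarrow> 'a matr \<Rightarrow> bool" where
  "mat_eq V A B \<longleftrightarrow> (\<forall>i\<in>V. \<forall>j\<in>V. A i j = B i j)"

definition mat_mul :: "'a set \<Rightarrow> 'a matr \<Rightarrow> 'a matr \<Rightarrow> 'a matr" where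
  "mat_mul V A B = (\<lambda>i j. \<Sum>k\<in>V. A i k * B k j)"

definition mat_id :: "'a matr" where
  "mat_id = (\<lambda>i j. if i = j then 1 else 0)"

definition mat_add :: "'a matr \<Rightarrow> 'a matr \<Rightarrow> 'a matr" where
  "mat_add A B = (\<lambda>i j. A i j + B i j)"

definition is_mat_inverse :: "'a set \<Rightarrow> 'a matr \<Rightarrow> 'a matr \<Rightarrow> bool" where
  "is_mat_inverse V A X \<longleftrightarrow>
     mat_eq V (mat_mul V A X) mat_id \<and> mat_eq V (mat_mul V X A) mat_id"

definition mat_inverse :: "'a set \<Rightarrow> 'a matr \<Rightarrow> 'a matr" where
  "mat_inverse V A = (THE X. mat_supp V X \<and> is_mat_inverse V A X)"

definition is_group_inverse :: "'a set \<Rightarrow> 'a matr \<Rightarrow> 'a matr \<Rightarrow> bool" where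
  "is_group_inverse V A X \<longleftrightarrow>
     mat_eq V (mat_mul V (mat_mul V A X) A) A \<and>
     mat_eq V (mat_mul V (mat_mul V X A) X) X \<and>
     mat_eq V (mat_mul V A X) (mat_mul V X A)"

definition group_inverse :: "'a set \<Rightarrow> 'a matr \<Rightarrow> 'a matr" where
  "group_inverse V A = (THE X. mat_supp V X \<and> is_group_inverse V A X)"

lemma mat_mul_assoc: "mat_mul V (mat_mul V A B) C = mat_mul V A (mat_mul V B C)"
  unfolding mat_mul_def
  by (intro ext, simp add: sum_distrib_left sum_distrib_right mult.assoc, rule sum.swap)

lemma mat_mul_cong:
  "mat_eq V A A' \<Longrightarrow> mat_eq V B B' \<Longrightarrow> mat_eq V (mat_mul V A B) (mat_mul V A' B')"
  by (auto simp: mat_eq_def mat_mul_def intro!: sum.cong)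

lemma mat_eq_refl [simp]: "mat_eq V A A"
  and mat_eq_sym: "mat_eq V A B \<Longrightarrow> mat_eq V B A"
  and mat_eq_trans [trans]: "mat_eq V A B \<Longrightarrow> mat_eq V B C \<Longrightarrow> mat_eq V A C"
  by (auto simp: mat_eq_def)

lemma mat_supp_eqI: "mat_supp V A \<Longrightarrow> mat_supp V B \<Longrightarrow> mat_eq V A B \<Longrightarrow> A = B"
  unfolding mat_supp_def mat_eq_def by (intro ext) metis

lemma mat_mul_id:
  assumes "finite V"
  shows "mat_eq V (mat_mul V A mat_id) A" "mat_eq V (mat_mul V mat_id A) A"
  using assms by (auto simp: mat_eq_def mat_mul_def mat_id_def if_distrib if_distribR
      cong: if_cong)

lemma mat_inverse_eqI:
  assumes "finite V" "mat_supp V X" "is_mat_inverse V A X"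
  shows "mat_inverse V A = X"
  unfolding mat_inverse_def
proof (rule the_equality)
  show "mat_supp V X \<and> is_mat_inverse V A X" using assms by simp
  fix Y assume Y: "mat_supp V Y \<and> is_mat_inverse V A Y"
  have "mat_eq V Y (mat_mul V Y mat_id)"
    by (rule mat_eq_sym[OF mat_mul_id(1)[OF assms(1)]])
  also have "mat_eq V \<dots> (mat_mul V Y (mat_mul V A X))"
    using assms by - (rule mat_mul_cong; auto simp: is_mat_inverse_def intro: mat_eq_sym)
  also have "mat_eq V \<dots> (mat_mul V mat_id X)"
    using Y unfolding mat_mul_assoc[symmetric]
    by - (rule mat_mul_cong; auto simp: is_mat_inverse_def)
  also have "mat_eq V \<dots> X" by (rule mat_mul_id(2)[OF assms(1)])
  finally show "Y = X" using Y assms by (intro mat_supp_eqI) auto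
qed

lemma group_inverse_eqI:
  assumes "mat_supp V X" "is_group_inverse V A X"
  shows "group_inverse V A = X"
  unfolding group_inverse_def
proof (rule the_equality)
  show "mat_supp V X \<and> is_group_inverse V A X" using assms by simp
  fix Y assume Y: "mat_supp V Y \<and> is_group_inverse V A Y"
  let ?m = "mat_mul V"
  note X' = assms(2)[unfolded is_group_inverse_def] and Y' = Y[unfolded is_group_inverse_def]
  have AX_AY: "mat_eq V (?m A X) (?m A Y)"
  proof -
    have "mat_eq V (?m A X) (?m X A)" using X' by simp
    also have "mat_eq V \<dots> (?m X (?m (?m A Y) A))"
      using Y' by - (rule mat_mul_cong; auto intro: mat_eq_sym)
    also have "?m X (?m (?m A Y) A) = ?m (?m X A) (?m Y A)" by (simp add: mat_mul_assoc)
    also have "mat_eq V \<dots> (?m (?m A X) (?m A Y))"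
      using X' Y' by - (rule mat_mul_cong; auto intro: mat_eq_sym)
    also have "?m (?m A X) (?m A Y) = ?m (?m (?m A X) A) Y" by (simp add: mat_mul_assoc)
    also have "mat_eq V \<dots> (?m A Y)" using X' by - (rule mat_mul_cong; auto)
    finally show ?thesis .
  qed
  have "mat_eq V Y (?m (?m Y A) Y)" using Y' by (auto intro: mat_eq_sym)
  also have "mat_eq V \<dots> (?m (?m A Y) Y)"
    using Y' by - (rule mat_mul_cong; auto intro: mat_eq_sym)
  also have "mat_eq V \<dots> (?m (?m A X) Y)"
    by (rule mat_mul_cong[OF mat_eq_sym[OF AX_AY] mat_eq_refl])
  also have "mat_eq V \<dots> (?m (?m X A) Y)" using X' by - (rule mat_mul_cong; auto)
  also have "?m (?m X A) Y = ?m X (?m A Y)" by (simp add: mat_mul_assoc)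
  also have "mat_eq V \<dots> (?m X (?m A X))"
    by (rule mat_mul_cong[OF mat_eq_refl mat_eq_sym[OF AX_AY]])
  also have "?m X (?m A X) = ?m (?m X A) X" by (simp add: mat_mul_assoc)
  also have "mat_eq V \<dots> X" using X' by simp
  finally show "Y = X" using Y assms by (intro mat_supp_eqI) auto
qed


section \<open>Laplacian and resistance distance\<close>

definition adjacency_mat :: "'a pair_pre_digraph \<Rightarrow> 'a matr" where
  "adjacency_mat G = (\<lambda>i j. if (i, j) \<in> parcs G then 1 else 0)"

definition degree_mat :: "'a pair_pre_digraph \<Rightarrow> 'a matr" where
  "degree_mat G = (\<lambda>i j. if i = j then real (out_degree (with_proj G) i) else 0)"

definition laplacian :: "'a pair_pre_digraph \<Rightarrow> 'a matr" where
  "laplacian G = (\<lambda>i j. degree_mat G i j - adjacency_mat G i j)"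

text \<open>
  Meaningful for connected graphs only. Provided the group inverse of the Laplacian exists, the
  last lemma of this theory identifies it with the effective resistance for unit resistors: the potential difference between \<open>u\<close> and \<open>v\<close> when a unit current
  enters at \<open>u\<close> and leaves at \<open>v\<close>.
\<close>

definition resistance :: "'a pair_pre_digraph \<Rightarrow> 'a \<Rightarrow> 'a \<Rightarrow> real" where
  "resistance G i j =
     (let X = group_inverse (pverts G) (laplacian G) in X i i + X j j - 2 * X i j)"

lemma laplacian_sym: "pair_graph G \<Longrightarrow> laplacian G i j = laplacian G j i"
proof -
  assume "pair_graph G"
  then interpret pair_graph G .
  have "(i, j) \<in> parcs G \<longleftrightarrow> (j, i) \<in> parcs G"
    using arcs_symmetric by blast
  then show ?thesis
    by (simp add: laplacian_def degree_mat_def adjacency_mat_def)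
qed

lemma mat_mul_transpose:
  "mat_mul V (\<lambda>i j. A j i) (\<lambda>i j. B j i) = (\<lambda>i j. mat_mul V B A j i)"
  by (simp add: mat_mul_def mult.commute)

lemma is_group_inverse_transpose:
  assumes "is_group_inverse V A X"
  shows "is_group_inverse V (\<lambda>i j. A j i) (\<lambda>i j. X j i)"
proof -
  define T where "T = (\<lambda>(B :: 'a matr) i j. B j i)"
  have T_mul: "mat_mul V (T B) (T C) = T (mat_mul V C B)" for B C
    unfolding T_def by (rule mat_mul_transpose)
  have T_eq: "mat_eq V B C \<Longrightarrow> mat_eq V (T B) (T C)" for B C
    by (simp add: T_def mat_eq_def)
  have "is_group_inverse V (T A) (T X)"
    using assms by (auto simp: is_group_inverse_def T_mul mat_mul_assoc intro: T_eq mat_eq_sym)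
  then show ?thesis by (simp add: T_def)
qed

lemma resistance_eq_potential_difference:
  assumes G: "pair_graph G" and V: "u \<in> pverts G" "v \<in> pverts G"
    and X: "mat_supp (pverts G) X" "is_group_inverse (pverts G) (laplacian G) X"
    and x: "\<forall>i\<in>pverts G. (\<Sum>k\<in>pverts G. laplacian G i k * x k) =
              (if i = u then 1 else 0) - (if i = v then 1 else 0)"
  shows "resistance G u v = x u - x v"
proof -
  let ?V = "pverts G" and ?L = "laplacian G"
  let ?m = "mat_mul ?V"
  define b :: "'a \<Rightarrow> real" where "b i = (if i = u then 1 else 0) - (if i = v then 1 else 0)" for i
  have fin: "finite ?V" using G by (simp add: pair_graph_def pair_digraph_def pair_fin_digraph.pair_finite_verts)
  have b_sum: "(\<Sum>k\<in>?V. b k * f k) = f u - f v" for f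
  proof -
    have "b k * f k = (if k = u then f k else 0) - (if k = v then f k else 0)" for k
      by (simp add: b_def)
    then show ?thesis using fin V by (simp add: sum_subtractf sum.delta)
  qed
  have sum_b: "(\<Sum>k\<in>?V. f k * b k) = f u - f v" for f
    using b_sum[of f] by (simp add: mult.commute)
  have X_eq: "group_inverse ?V ?L = X" using X by (rule group_inverse_eqI)
  have LT: "(\<lambda>i j. ?L j i) = ?L" using laplacian_sym[OF G] by (intro ext) metis
  have "group_inverse ?V ?L = (\<lambda>i j. X j i)"
  proof (rule group_inverse_eqI)
    show "mat_supp ?V (\<lambda>i j. X j i)" using X(1) by (auto simp: mat_supp_def)
    show "is_group_inverse ?V ?L (\<lambda>i j. X j i)"
      using is_group_inverse_transpose[OF X(2)] by (simp only: LT)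
  qed
  then have X_sym: "X v u = X u v" unfolding X_eq by metis
  let ?c = "\<lambda>k _. x k" and ?r = "\<lambda>_ k. x k" and ?bc = "\<lambda>k _. b k" and ?br = "\<lambda>_ k. b k"
  have col: "mat_eq ?V (?m ?L ?c) ?bc"
    using x by (simp add: mat_eq_def mat_mul_def b_def)
  have row: "mat_eq ?V (?m ?r ?L) ?br"
  proof -
    have "(\<Sum>k\<in>?V. x k * ?L k j) = (\<Sum>k\<in>?V. ?L j k * x k)" for j
      by (intro sum.cong refl) (metis laplacian_sym[OF G] mult.commute)
    then show ?thesis
      using x by (simp add: mat_eq_def mat_mul_def b_def)
  qed
  have "mat_eq ?V (?m (?m ?br X) ?bc) (?m (?m (?m ?r ?L) X) (?m ?L ?c))"
    by (rule mat_mul_cong[OF mat_mul_cong[OF mat_eq_sym[OF row] mat_eq_refl] mat_eq_sym[OF col]])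
  also have "?m (?m (?m ?r ?L) X) (?m ?L ?c) = ?m (?m ?r (?m (?m ?L X) ?L)) ?c"
    by (simp add: mat_mul_assoc)
  also have "mat_eq ?V \<dots> (?m (?m ?r ?L) ?c)"
    using X(2) unfolding is_group_inverse_def
    by (blast intro: mat_mul_cong[OF mat_mul_cong[OF mat_eq_refl] mat_eq_refl])
  also have "mat_eq ?V \<dots> (?m ?br ?c)" by (rule mat_mul_cong[OF row mat_eq_refl])
  finally have "?m (?m ?br X) ?bc u u = ?m ?br ?c u u"
    using V by (auto simp: mat_eq_def)
  then have "(X u u - X v u) - (X u v - X v v) = x u - x v"
    by (simp add: mat_mul_def b_sum sum_b)
  then show ?thesis by (simp add: resistance_def X_eq X_sym)
qed

end

theory Submission
  imports Defs
begin

text \<open>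
  Ground the identified vertex \<open>u\<close>. Deleting its row and column from the Laplacian leaves the
  block diagonal matrix with blocks \<open>I\<close> (the leaves of the star) and \<open>L(G) + I\<close>, so the inverse
  \<open>Y\<close> of the grounded Laplacian has blocks \<open>I\<close> and \<open>M\<close>. Extended by zero to \<open>u\<close>, it satisfies
  \<open>L Y = I - e\<^sub>u 1\<^sup>T\<close>. With \<open>P = I - J/N\<close> the orthogonal projection along the constant vectors,
  \<open>P Y P\<close> is the group inverse of \<open>L\<close>, and the columns of \<open>Y\<close> are potentials, which gives
  \<open>r\<^sub>i\<^sub>j = Y\<^sub>i\<^sub>i + Y\<^sub>j\<^sub>j - Y\<^sub>i\<^sub>j - Y\<^sub>j\<^sub>i\<close>.
\<close>

section \<open>Inverses of positive definite matrices\<close>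

definition pos_def_on :: "'a set \<Rightarrow> 'a matr \<Rightarrow> bool" where
  "pos_def_on V A \<longleftrightarrow>
     (\<forall>x. (\<exists>i\<in>V. x i \<noteq> 0) \<longrightarrow> (\<Sum>i\<in>V. x i * (\<Sum>k\<in>V. A i k * x k)) > 0)"

text \<open>Gaussian elimination: the Schur complement of a diagonal entry is again positive definite.\<close>

lemma pos_def_on_solvable:
  assumes "finite V" "pos_def_on V A"
  shows "\<exists>x. \<forall>i\<in>V. (\<Sum>k\<in>V. A i k * x k) = b i"
  using assms
proof (induction V arbitrary: A b rule: finite_induct)
  case empty
  then show ?case by simp
next
  case (insert v V)
  define S where "S i k = A i k - A i v * A v k / A v v" for i k
  \<comment> \<open>Testing the form on the unit vector at \<open>v\<close> shows that the pivot
    \<open>A v v\<close> is positive.\<close>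
  have "(\<Sum>i\<in>insert v V. (if i = v then 1 else 0) *
      (\<Sum>k\<in>insert v V. A i k * (if k = v then 1 else 0))) > 0"
    using insert.prems unfolding pos_def_on_def by (elim allE impE) auto
  moreover have "(\<Sum>k\<in>insert v V. A v k * (if k = v then 1 else 0)) = A v v"
    using insert.hyps by (simp add: if_distrib cong: if_cong)
  moreover have "(\<Sum>i\<in>insert v V. (if i = v then 1 else 0) *
      (\<Sum>k\<in>insert v V. A i k * (if k = v then 1 else 0))) =
      (\<Sum>k\<in>insert v V. A v k * (if k = v then 1 else 0))"
  proof -
    have "(\<Sum>i\<in>V. (if i = v then 1 else 0) *
      (\<Sum>k\<in>insert v V. A i k * (if k = v then 1 else 0))) = 0"
      using insert.hyps by (intro sum.neutral) auto
    then show ?thesis using insert.hyps by simp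
  qed
  ultimately have Avv: "A v v > 0" by simp
  \<comment> \<open>The value put at \<open>v\<close> makes row \<open>v\<close> evaluate to
    \<open>c\<close>; each row then reduces to \<open>S\<close> on \<open>V\<close> plus a multiple
    of \<open>c\<close>. Below, \<open>c = 0\<close> transfers positivity and \<open>c = b v\<close>
    gives back substitution.\<close>
  have elim: "(\<Sum>k\<in>insert v V. A i k * (x(v := (c - (\<Sum>k\<in>V. A v k * x k)) / A v v)) k) =
      (\<Sum>k\<in>V. S i k * x k) + A i v * c / A v v" for x :: "'a \<Rightarrow> real" and i c
  proof -
    have "(\<Sum>k\<in>V. A i k * (x(v := z)) k) = (\<Sum>k\<in>V. A i k * x k)" for z
      using insert.hyps by (intro sum.cong) auto
    moreover have "(\<Sum>k\<in>V. S i k * x k) =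
        (\<Sum>k\<in>V. A i k * x k) - A i v / A v v * (\<Sum>k\<in>V. A v k * x k)"
      by (simp add: S_def left_diff_distrib sum_subtractf sum_distrib_left mult.assoc)
    ultimately show ?thesis
      using insert.hyps Avv by (simp add: field_simps)
  qed
  have S_v: "S v k = 0" for k
    using Avv by (simp add: S_def)
  have "pos_def_on V S"
    unfolding pos_def_on_def
  proof (intro allI impI)
    fix x :: "'a \<Rightarrow> real"
    assume nz: "\<exists>i\<in>V. x i \<noteq> 0"
    \<comment> \<open>Row \<open>v\<close> of \<open>A\<close> vanishes at \<open>y\<close>, so
      \<open>y v\<close> drops out and the form of \<open>A\<close> at \<open>y\<close> is that of
      \<open>S\<close> at \<open>x\<close>.\<close>
    define y where "y = x(v := (0 - (\<Sum>k\<in>V. A v k * x k)) / A v v)"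
    have Ay: "(\<Sum>k\<in>insert v V. A i k * y k) = (\<Sum>k\<in>V. S i k * x k)" for i
      using elim[of i x 0] by (simp add: y_def)
    have "\<exists>i\<in>insert v V. y i \<noteq> 0"
      using nz insert.hyps by (auto simp: y_def)
    then have "(\<Sum>i\<in>insert v V. y i * (\<Sum>k\<in>insert v V. A i k * y k)) > 0"
      using insert.prems by (simp only: pos_def_on_def)
    also have "(\<Sum>i\<in>insert v V. y i * (\<Sum>k\<in>insert v V. A i k * y k)) =
        (\<Sum>i\<in>V. y i * (\<Sum>k\<in>V. S i k * x k))"
      unfolding Ay using insert.hyps by (simp add: S_v)
    also have "\<dots> = (\<Sum>i\<in>V. x i * (\<Sum>k\<in>V. S i k * x k))"
      using insert.hyps by (intro sum.cong) (auto simp: y_def)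
    finally show "(\<Sum>i\<in>V. x i * (\<Sum>k\<in>V. S i k * x k)) > 0" .
  qed
  from insert.IH[OF this, of "\<lambda>i. b i - A i v * b v / A v v"]
  obtain x where x: "\<forall>i\<in>V. (\<Sum>k\<in>V. S i k * x k) = b i - A i v * b v / A v v"
    by blast
  define y where "y = x(v := (b v - (\<Sum>k\<in>V. A v k * x k)) / A v v)"
  have "(\<Sum>k\<in>insert v V. A i k * y k) = b i" if "i \<in> insert v V" for i
    using that x Avv S_v unfolding y_def elim by auto
  then show ?case by blast
qed

text \<open>Solving for every unit vector gives a right inverse. Its transpose is a left inverse
  because \<open>A\<close> is symmetric, and a left and a right inverse coincide, so existence and
  symmetry come together.\<close>

lemma pos_def_on_inverse:
  assumes fin: "finite V" and sym: "\<And>i j. A i j = A j i" and pos: "pos_def_on V A"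
  shows "is_mat_inverse V A (mat_inverse V A)"
    and "mat_inverse V A i j = mat_inverse V A j i"
proof -
  let ?m = "mat_mul V"
  have "\<forall>j. \<exists>x. \<forall>i\<in>V. (\<Sum>k\<in>V. A i k * x k) = mat_id i j"
    by (intro allI pos_def_on_solvable[OF fin pos])
  from choice[OF this]
  obtain x where x: "\<And>i j. i \<in> V \<Longrightarrow> (\<Sum>k\<in>V. A i k * x j k) = mat_id i j"
    by blast
  \<comment> \<open>Zero outside \<open>V\<close>, the normalisation built into
    \<open>mat_inverse\<close>; it also makes the symmetry hold for all indices.\<close>
  define X where "X i j = (if i \<in> V \<and> j \<in> V then x j i else 0)" for i j
  define XT where "XT i j = X j i" for i j
  have supp: "mat_supp V X" "mat_supp V XT"
    by (auto simp: mat_supp_def X_def XT_def)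
  have right: "mat_eq V (?m A X) mat_id"
    using x by (simp add: mat_eq_def mat_mul_def X_def)
  have "?m XT A = (\<lambda>i j. ?m A X j i)"
    using mat_mul_transpose[of V X A] sym by (simp add: XT_def[abs_def] mat_mul_def)
  then have left: "mat_eq V (?m XT A) mat_id"
    using right by (auto simp: mat_eq_def mat_id_def)
  have "mat_eq V XT (?m XT mat_id)"
    by (rule mat_eq_sym[OF mat_mul_id(1)[OF fin]])
  also have "mat_eq V \<dots> (?m XT (?m A X))"
    by (rule mat_mul_cong[OF mat_eq_refl mat_eq_sym[OF right]])
  also have "?m XT (?m A X) = ?m (?m XT A) X" by (simp add: mat_mul_assoc)
  also have "mat_eq V \<dots> (?m mat_id X)" by (rule mat_mul_cong[OF left mat_eq_refl])
  also have "mat_eq V \<dots> X" by (rule mat_mul_id(2)[OF fin])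
  finally have XT: "XT = X" by (rule mat_supp_eqI[OF supp(2,1)])
  then have inv: "is_mat_inverse V A X"
    using left right by (simp add: is_mat_inverse_def)
  have eq: "mat_inverse V A = X"
    by (rule mat_inverse_eqI[OF fin supp(1) inv])
  show "is_mat_inverse V A (mat_inverse V A)" using inv by (simp add: eq)
  show "mat_inverse V A i j = mat_inverse V A j i"
    using XT unfolding eq XT_def by metis
qed

section \<open>The Laplacian\<close>

lemma pair_graph_finite_verts: "pair_graph G \<Longrightarrow> finite (pverts G)"
  by (simp add: pair_graph_def pair_digraph_def pair_fin_digraph.pair_finite_verts)

lemma adjacency_mat_sym:
  assumes "pair_graph G"
  shows "adjacency_mat G i j = adjacency_mat G j i"
proof -
  interpret pair_graph G by fact
  show ?thesis using arcs_symmetric by (auto simp: adjacency_mat_def)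
qed

lemma out_degree_eq_sum_adjacency:
  assumes "pair_graph G"
  shows "real (out_degree (with_proj G) i) = (\<Sum>k\<in>pverts G. adjacency_mat G i k)"
proof -
  interpret pair_graph G by fact
  have fin: "finite (pverts G)" using assms by (rule pair_graph_finite_verts)
  have "out_arcs (with_proj G) i = Pair i ` {k \<in> pverts G. (i, k) \<in> parcs G}"
    using in_arcsD2 by (auto simp: out_arcs_def)
  then have "out_degree (with_proj G) i = card {k \<in> pverts G. (i, k) \<in> parcs G}"
    by (simp add: out_degree_def card_image inj_on_def)
  then show ?thesis
    using fin by (simp add: adjacency_mat_def sum.If_cases Int_def)
qed

text \<open>The net current leaving \<open>i\<close> at potentials \<open>x\<close>. Degrees
  disappear in this form, so for the star cone only adjacencies have to be computed.\<close>

lemma laplacian_apply: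
  assumes "pair_graph G" "i \<in> pverts G"
  shows "(\<Sum>k\<in>pverts G. laplacian G i k * x k) =
    (\<Sum>k\<in>pverts G. adjacency_mat G i k * (x i - x k))"
proof -
  have fin: "finite (pverts G)" using assms(1) by (rule pair_graph_finite_verts)
  have "(\<Sum>k\<in>pverts G. degree_mat G i k * x k) =
      (\<Sum>k\<in>pverts G. if i = k then real (out_degree (with_proj G) i) * x i else 0)"
    by (intro sum.cong) (auto simp: degree_mat_def)
  also have "\<dots> = (\<Sum>k\<in>pverts G. adjacency_mat G i k * x i)"
    using fin assms(2) by (simp add: out_degree_eq_sum_adjacency[OF assms(1)] sum_distrib_right)
  finally show ?thesis
    by (simp add: laplacian_def left_diff_distrib right_diff_distrib sum_subtractf)
qed

lemma laplacian_row_sum: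
  assumes "pair_graph G" "i \<in> pverts G"
  shows "(\<Sum>k\<in>pverts G. laplacian G i k) = 0"
  using laplacian_apply[OF assms, of "\<lambda>_. 1"] by simp

lemma laplacian_col_sum:
  assumes "pair_graph G" "j \<in> pverts G"
  shows "(\<Sum>k\<in>pverts G. laplacian G k j) = 0"
  using laplacian_row_sum[OF assms] laplacian_sym[OF assms(1)] by simp

text \<open>The Dirichlet energy. The right-hand side runs over ordered pairs and counts each edge
  twice, whence the factor 2.\<close>

lemma laplacian_quadratic_form:
  assumes "pair_graph G"
  shows "2 * (\<Sum>i\<in>pverts G. x i * (\<Sum>k\<in>pverts G. laplacian G i k * x k)) =
    (\<Sum>i\<in>pverts G. \<Sum>k\<in>pverts G. adjacency_mat G i k * (x i - x k)\<^sup>2)"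
proof -
  let ?V = "pverts G" and ?a = "adjacency_mat G"
  define q where "q = (\<Sum>i\<in>?V. \<Sum>k\<in>?V. ?a i k * x i * (x i - x k))"
  have eq: "(\<Sum>i\<in>?V. x i * (\<Sum>k\<in>?V. laplacian G i k * x k)) = q"
    unfolding q_def
    by (intro sum.cong refl, simp only: laplacian_apply[OF assms])
      (simp add: sum_distrib_left mult_ac)
  \<comment> \<open>Swapping the indices, by symmetry of adjacency, gives a second expression for
    \<open>q\<close>; the two add up to squares.\<close>
  have "q = (\<Sum>i\<in>?V. \<Sum>k\<in>?V. ?a k i * x k * (x k - x i))"
    unfolding q_def by (rule sum.swap)
  also have "\<dots> = (\<Sum>i\<in>?V. \<Sum>k\<in>?V. ?a i k * x k * (x k - x i))"
    by (intro sum.cong refl) (metis adjacency_mat_sym[OF assms])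
  finally have "2 * q = (\<Sum>i\<in>?V. \<Sum>k\<in>?V. ?a i k * x i * (x i - x k)) +
      (\<Sum>i\<in>?V. \<Sum>k\<in>?V. ?a i k * x k * (x k - x i))"
    by (simp add: q_def)
  also have "\<dots> = (\<Sum>i\<in>?V. \<Sum>k\<in>?V. ?a i k * (x i - x k)\<^sup>2)"
    unfolding sum.distrib[symmetric]
    by (intro sum.cong refl) (simp add: power2_eq_square algebra_simps)
  finally show ?thesis by (simp add: eq)
qed

text \<open>Although the Laplacian kills constant vectors, its energy is nonnegative, and the
  identity adds the squared norm.\<close>

lemma pos_def_laplacian_plus_id:
  assumes "pair_graph G"
  shows "pos_def_on (pverts G) (mat_add (laplacian G) mat_id)"
  unfolding pos_def_on_def
proof (intro allI impI)
  fix x :: "'a \<Rightarrow> real"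
  let ?V = "pverts G"
  have fin: "finite ?V" using assms by (rule pair_graph_finite_verts)
  assume "\<exists>i\<in>?V. x i \<noteq> 0"
  then obtain i where "i \<in> ?V" "x i * x i > 0"
    by (auto simp: zero_less_mult_iff neq_iff)
  then have "(\<Sum>i\<in>?V. x i * x i) > 0"
    using sum_pos2[OF fin, of i "\<lambda>i. x i * x i"] by simp
  moreover have "(\<Sum>i\<in>?V. x i * (\<Sum>k\<in>?V. laplacian G i k * x k)) \<ge> 0"
  proof -
    have "2 * (\<Sum>i\<in>?V. x i * (\<Sum>k\<in>?V. laplacian G i k * x k)) \<ge> 0"
      unfolding laplacian_quadratic_form[OF assms]
      by (intro sum_nonneg) (simp add: adjacency_mat_def)
    then show ?thesis by simp
  qed
  moreover have "(\<Sum>k\<in>?V. mat_id i k * x k) = x i" if "i \<in> ?V" for i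
    using mat_mul_id(2)[OF fin, of "\<lambda>k _. x k"] that by (auto simp: mat_eq_def mat_mul_def)
  ultimately show "(\<Sum>i\<in>?V. x i * (\<Sum>k\<in>?V. mat_add (laplacian G) mat_id i k * x k)) > 0"
    by (simp add: mat_add_def distrib_right distrib_left sum.distrib cong: sum.cong)
qed

section \<open>Resistance from the grounded Laplacian\<close>

lemma is_group_inverse_cong:
  assumes "mat_eq V X X'" "is_group_inverse V A X'"
  shows "is_group_inverse V A X"
proof -
  have AX: "mat_eq V (mat_mul V A X) (mat_mul V A X')"
    and XA: "mat_eq V (mat_mul V X A) (mat_mul V X' A)"
    using assms(1) by (auto intro: mat_mul_cong)
  show ?thesis
    unfolding is_group_inverse_def
    using assms mat_mul_cong[OF AX mat_eq_refl[of V A]] mat_mul_cong[OF XA assms(1)] AX XA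
    unfolding is_group_inverse_def by (meson mat_eq_sym mat_eq_trans)
qed

text \<open>For \<open>X = PYP\<close> all three conditions follow from \<open>LX = P = XL\<close>,
  \<open>PL = L\<close> and \<open>PX = X\<close>.\<close>

lemma laplacian_group_inverse_exists:
  assumes G: "pair_graph G" and u: "u \<in> pverts G"
    and sym: "\<And>i j. Y i j = Y j i"
    and LY: "mat_eq (pverts G) (mat_mul (pverts G) (laplacian G) Y)
      (\<lambda>i j. mat_id i j - mat_id i u)"
  shows "\<exists>X. mat_supp (pverts G) X \<and> is_group_inverse (pverts G) (laplacian G) X"
proof -
  let ?V = "pverts G" and ?L = "laplacian G"
  let ?m = "mat_mul ?V" and ?N = "real (card ?V)"
  \<comment> \<open>\<open>E\<close> is the given value of \<open>LY\<close>, a rank one change of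
    the identity; its transpose \<open>F\<close> will be \<open>YL\<close>.\<close>
  define E :: "'a matr" where "E i j = mat_id i j - mat_id i u" for i j
  define F :: "'a matr" where "F i j = mat_id i j - mat_id u j" for i j
  define P :: "'a matr" where "P i j = mat_id i j - 1 / ?N" for i j
  have fin: "finite ?V" using G by (rule pair_graph_finite_verts)
  have N: "?N \<noteq> 0" using fin u by auto
  have id_sums: "(\<Sum>k\<in>?V. mat_id i k * f k) = f i" "(\<Sum>k\<in>?V. mat_id k i * f k) = f i"
    "(\<Sum>k\<in>?V. f k * mat_id k i) = f i" "(\<Sum>k\<in>?V. mat_id k i) = 1" "(\<Sum>k\<in>?V. mat_id i k) = 1"
    if "i \<in> ?V" for i and f :: "'a \<Rightarrow> real"
    using fin that by (simp_all add: mat_id_def if_distrib if_distribR cong: if_cong)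
  note calc = mat_eq_def mat_mul_def left_diff_distrib right_diff_distrib sum_subtractf
    id_sums sum_divide_distrib[symmetric]
  have LP: "mat_eq ?V (?m ?L P) ?L"
    by (simp add: P_def calc laplacian_row_sum[OF G])
  have PL: "mat_eq ?V (?m P ?L) ?L"
    by (simp add: P_def calc laplacian_col_sum[OF G])
  have PP: "mat_eq ?V (?m P P) P"
    using N by (simp add: P_def calc)
  \<comment> \<open>The columns of \<open>P\<close> sum to zero, which kills the rank one part of
    \<open>E\<close>; its rows do so too, which kills that of \<open>F\<close>.\<close>
  have EP: "mat_eq ?V (?m E P) P"
    using u N by (simp add: P_def E_def calc sum_distrib_left[symmetric] diff_divide_distrib)
  have PF: "mat_eq ?V (?m P F) P"
    using u N by (simp add: P_def F_def calc sum_distrib_left[symmetric] diff_divide_distrib)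
  have LY: "mat_eq ?V (?m ?L Y) E"
    using LY by (simp add: E_def[abs_def])
  have "?m Y ?L i j = ?m ?L Y j i" for i j
    by (simp add: mat_mul_def sym[of i] laplacian_sym[OF G, of _ j] mult.commute)
  then have YL: "mat_eq ?V (?m Y ?L) F"
    using LY by (auto simp: mat_eq_def E_def F_def mat_id_def)
  define X0 where "X0 = ?m P (?m Y P)"
  have LX: "mat_eq ?V (?m ?L X0) P"
  proof -
    have "mat_eq ?V (?m (?m (?m ?L P) Y) P) (?m (?m ?L Y) P)"
      by (intro mat_mul_cong LP mat_eq_refl)
    also have "mat_eq ?V \<dots> (?m E P)"
      by (intro mat_mul_cong LY mat_eq_refl)
    also note EP
    finally show ?thesis by (simp add: X0_def mat_mul_assoc)
  qed
  have XL: "mat_eq ?V (?m X0 ?L) P"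
  proof -
    have "mat_eq ?V (?m P (?m Y (?m P ?L))) (?m P (?m Y ?L))"
      by (intro mat_mul_cong PL mat_eq_refl)
    also have "mat_eq ?V \<dots> (?m P F)"
      by (intro mat_mul_cong YL mat_eq_refl)
    also note PF
    finally show ?thesis by (simp add: X0_def mat_mul_assoc)
  qed
  have "mat_eq ?V (?m P X0) X0"
    unfolding X0_def mat_mul_assoc[symmetric]
    by (intro mat_mul_cong PP mat_eq_refl)
  then have "is_group_inverse ?V ?L X0"
    unfolding is_group_inverse_def
    using mat_eq_trans[OF mat_mul_cong[OF LX mat_eq_refl] PL]
      mat_eq_trans[OF mat_mul_cong[OF XL mat_eq_refl]]
      mat_eq_trans[OF LX mat_eq_sym[OF XL]]
    by blast
  \<comment> \<open>Cutting \<open>X0\<close> off outside the vertex set provides the support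
    condition and changes no relevant entry.\<close>
  then have "is_group_inverse ?V ?L (\<lambda>i j. if i \<in> ?V \<and> j \<in> ?V then X0 i j else 0)"
    by (rule is_group_inverse_cong[rotated]) (simp add: mat_eq_def)
  then show ?thesis
    by (intro exI[of _ "\<lambda>i j. if i \<in> ?V \<and> j \<in> ?V then X0 i j else 0"]) (auto simp: mat_supp_def)
qed

text \<open>The Laplacian sends column \<open>i\<close> minus column \<open>j\<close> of
  \<open>Y\<close> to the difference of the unit vectors at \<open>i\<close> and \<open>j\<close>,
  as the parts at \<open>u\<close> cancel. So this difference is a potential for a unit current from
  \<open>i\<close> to \<open>j\<close>.\<close>

lemma resistance_grounded:
  assumes G: "pair_graph G" and u: "u \<in> pverts G"
    and sym: "\<And>i j. Y i j = Y j i"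
    and LY: "mat_eq (pverts G) (mat_mul (pverts G) (laplacian G) Y)
      (\<lambda>i j. mat_id i j - mat_id i u)"
    and ij: "i \<in> pverts G" "j \<in> pverts G"
  shows "resistance G i j = Y i i + Y j j - 2 * Y i j"
proof -
  obtain X where X: "mat_supp (pverts G) X" "is_group_inverse (pverts G) (laplacian G) X"
    using laplacian_group_inverse_exists[OF G u sym LY] by blast
  have "resistance G i j = (Y i i - Y i j) - (Y j i - Y j j)"
    using LY ij
    by (intro resistance_eq_potential_difference[OF G ij X])
      (simp add: mat_eq_def mat_mul_def mat_id_def right_diff_distrib sum_subtractf)
  then show ?thesis by (simp add: sym[of j i])
qed

section \<open>The star glued to a cone\<close>

text \<open>\<open>Inl 0\<close> is the identified vertex, \<open>Inl l\<close> with
  \<open>0 < l < p\<close> are the leaves, and \<open>Inr (Inl v)\<close> are the vertices of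
  \<open>G\<close>; \<open>Inr (Inr ())\<close> is absorbed into \<open>Inl 0\<close>.\<close>

definition star_cone :: "nat \<Rightarrow> 'a pair_pre_digraph \<Rightarrow> (nat + ('a + unit)) pair_pre_digraph" where
  "star_cone p G = coalescence (star_graph p) 0 (graph_join G K1) (Inr ())"

lemma pverts_star_cone:
  assumes "p \<ge> 1"
  shows "pverts (star_cone p G) = Inl ` {..<p} \<union> (Inr \<circ> Inl) ` pverts G"
  using assms
  by (auto simp: star_cone_def coalescence_def star_graph_def graph_join_def K1_def glue_map_def
      image_Un image_image)

lemma parcs_star_cone:
  "parcs (star_cone p G) =
     {Inl 0} \<times> Inl ` {1..<p} \<union> Inl ` {1..<p} \<times> {Inl 0} \<union>
     {(Inr (Inl v), Inr (Inl w)) | v w. (v, w) \<in> parcs G} \<union>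
     (Inr \<circ> Inl) ` pverts G \<times> {Inl 0} \<union> {Inl 0} \<times> (Inr \<circ> Inl) ` pverts G"
proof -
  have star: "map_prod Inl Inl ` parcs (star_graph p) =
      ({Inl 0} \<times> Inl ` {1..<p} \<union> Inl ` {1..<p} \<times> {Inl 0} :: ((nat + ('a + unit)) \<times> _) set)"
    by (simp add: star_graph_def image_Un map_prod_def image_paired_Times)
  let ?g = "glue_map (0::nat) (Inr () :: 'a + unit)"
  have g: "?g (Inl v) = Inr (Inl v)" "?g (Inr ()) = Inl 0" for v
    by (simp_all add: glue_map_def)
  have cone: "map_prod ?g ?g ` parcs (graph_join G K1) =
     {(Inr (Inl v), Inr (Inl w)) | v w. (v, w) \<in> parcs G} \<union>
     (Inr \<circ> Inl) ` pverts G \<times> {Inl 0} \<union> {Inl 0} \<times> (Inr \<circ> Inl) ` pverts G"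
  proof -
    have "map_prod ?g ?g ` map_prod Inl Inl ` parcs G =
        {(Inr (Inl v), Inr (Inl w)) | v w. (v, w) \<in> parcs G}"
      by (force simp: g)
    moreover have "map_prod ?g ?g ` (Inl ` pverts G \<times> {Inr ()}) = (Inr \<circ> Inl) ` pverts G \<times> {Inl 0}"
      "map_prod ?g ?g ` ({Inr ()} \<times> Inl ` pverts G) = {Inl 0} \<times> (Inr \<circ> Inl) ` pverts G"
      by (simp_all add: map_prod_def image_paired_Times image_image g)
    ultimately show ?thesis
      by (simp only: graph_join_def K1_def pair_pre_digraph.simps image_Un image_insert image_empty
          Un_empty_right)
  qed
  show ?thesis
    unfolding star_cone_def coalescence_def
    by (simp only: pair_pre_digraph.simps star cone Un_assoc)
qed

lemma adjacency_star_cone: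
  "\<lbrakk>l < p; l' < p\<rbrakk> \<Longrightarrow>
     adjacency_mat (star_cone p G) (Inl l) (Inl l') = (if (l = 0) \<noteq> (l' = 0) then 1 else 0)"
  "v \<in> pverts G \<Longrightarrow>
     adjacency_mat (star_cone p G) (Inl l) (Inr (Inl v)) = (if l = 0 then 1 else 0)"
  "v \<in> pverts G \<Longrightarrow>
     adjacency_mat (star_cone p G) (Inr (Inl v)) (Inl l) = (if l = 0 then 1 else 0)"
  "adjacency_mat (star_cone p G) (Inr (Inl v)) (Inr (Inl w)) = adjacency_mat G v w"
  by (auto simp: adjacency_mat_def parcs_star_cone)

lemma pair_graph_star_cone:
  assumes "pair_graph G" "p \<ge> 1"
  shows "pair_graph (star_cone p G)"
proof -
  interpret pair_graph G by fact
  show ?thesis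
  proof (rule pair_graphI_simple)
    show "finite (pverts (star_cone p G))"
      using pair_graph_finite_verts[OF assms(1)] assms(2) by (simp add: pverts_star_cone)
    show "parcs (star_cone p G) \<subseteq> pverts (star_cone p G) \<times> pverts (star_cone p G)"
      using assms(2) in_arcsD1 in_arcsD2
      by (auto simp: pverts_star_cone parcs_star_cone)
    show "sym (parcs (star_cone p G))"
      using arcs_symmetric by (auto simp: sym_def parcs_star_cone)
    show "irrefl (parcs (star_cone p G))"
      using pair_no_loops by (fastforce simp: irrefl_def parcs_star_cone)
  qed
qed

section \<open>The grounded inverse on the star cone\<close>

lemma sum_star_cone:
  assumes "pair_graph G" "p \<ge> 1"
  shows "(\<Sum>k\<in>pverts (star_cone p G). f k) =
    f (Inl 0) + (\<Sum>l\<in>{1..<p}. f (Inl l)) + (\<Sum>v\<in>pverts G. f (Inr (Inl v)))"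
proof -
  have fin: "finite (pverts G)" using assms(1) by (rule pair_graph_finite_verts)
  have "(\<Sum>k\<in>pverts (star_cone p G). f k) =
      (\<Sum>k\<in>Inl ` {..<p}. f k) + (\<Sum>k\<in>(Inr \<circ> Inl) ` pverts G. f k)"
    unfolding pverts_star_cone[OF assms(2)] using fin by (intro sum.union_disjoint) auto
  also have "(\<Sum>k\<in>Inl ` {..<p}. f k) = (\<Sum>l<p. f (Inl l))"
    by (simp add: sum.reindex)
  also have "\<dots> = f (Inl 0) + (\<Sum>l\<in>{1..<p}. f (Inl l))"
    using assms(2) by (simp add: lessThan_atLeast0 sum.atLeast_Suc_lessThan)
  also have "(\<Sum>k\<in>(Inr \<circ> Inl) ` pverts G. f k) = (\<Sum>v\<in>pverts G. f (Inr (Inl v)))"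
    by (simp add: sum.reindex inj_on_def)
  finally show ?thesis .
qed

text \<open>With \<open>M\<close> the inverse of \<open>L(G) + I\<close>, the column of a vertex
  holds the potentials when a unit current enters there and leaves at the grounded centre, hence the
  zeros at \<open>Inl 0\<close>. \<open>Inr (Inr ())\<close> is no vertex and gets the default
  0.\<close>

fun star_cone_potential :: "'a matr \<Rightarrow> (nat + ('a + unit)) matr" where
  "star_cone_potential M (Inl l) (Inl l') = (if l = l' \<and> l \<noteq> 0 then 1 else 0)"
| "star_cone_potential M (Inr (Inl v)) (Inr (Inl w)) = M v w"
| "star_cone_potential M _ _ = 0"

lemma star_cone_potential_sym:
  assumes "\<And>v w. M v w = M w v"
  shows "star_cone_potential M i j = star_cone_potential M j i"
  by (cases "(M, i, j)" rule: star_cone_potential.cases) (auto intro: assms)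

text \<open>A current balance at each vertex. At a vertex of \<open>G\<close>, the edge to the
  grounded centre supplies the identity next to \<open>L(G)\<close>; a leaf has that edge only; at
  the centre, the balance for a column from \<open>G\<close> is a column sum of
  \<open>M\<close>.\<close>

lemma laplacian_star_cone_potential:
  assumes G: "pair_graph G" and p: "p \<ge> 1"
    and M: "mat_eq (pverts G) (mat_mul (pverts G) (mat_add (laplacian G) mat_id) M) mat_id"
  shows "mat_eq (pverts (star_cone p G))
    (mat_mul (pverts (star_cone p G)) (laplacian (star_cone p G)) (star_cone_potential M))
    (\<lambda>i j. mat_id i j - mat_id i (Inl 0))"
proof -
  let ?H = "star_cone p G" and ?V = "pverts G" and ?Y = "star_cone_potential M"
  have fin: "finite ?V" using G by (rule pair_graph_finite_verts)
  have LM: "(\<Sum>k\<in>?V. laplacian G v k * M k w) + M v w = mat_id v w"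
    if "v \<in> ?V" "w \<in> ?V" for v w
  proof -
    have "(\<Sum>k\<in>?V. mat_id v k * M k w) = M v w"
      using mat_mul_id(2)[OF fin, of M] that by (simp add: mat_eq_def mat_mul_def)
    then show ?thesis
      using M that
      by (simp add: mat_eq_def mat_mul_def mat_add_def distrib_right sum.distrib) metis
  qed
  \<comment> \<open>Sum \<open>(L + I) M = I\<close> over the rows: the columns of \<open>L\<close>
    sum to zero, so those of \<open>M\<close> sum to one.\<close>
  have colsum: "(\<Sum>v\<in>?V. M v w) = 1" if "w \<in> ?V" for w
  proof -
    have "(\<Sum>v\<in>?V. \<Sum>k\<in>?V. laplacian G v k * M k w) = (\<Sum>k\<in>?V. (\<Sum>v\<in>?V. laplacian G v k) * M k w)"
      unfolding sum_distrib_right by (rule sum.swap)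
    also have "\<dots> = 0" by (simp add: laplacian_col_sum[OF G])
    finally have "(\<Sum>v\<in>?V. M v w) = (\<Sum>v\<in>?V. (\<Sum>k\<in>?V. laplacian G v k * M k w) + M v w)"
      by (simp add: sum.distrib)
    also have "\<dots> = (\<Sum>v\<in>?V. mat_id v w)"
      using LM that by simp
    also have "\<dots> = 1"
      using fin that by (simp add: mat_id_def)
    finally show ?thesis .
  qed
  have "(\<Sum>k\<in>pverts ?H. adjacency_mat ?H i k * (?Y i j - ?Y k j)) = mat_id i j - mat_id i (Inl 0)"
    if i: "i \<in> pverts ?H" and j: "j \<in> pverts ?H" for i j
  proof -
    note s = sum_star_cone[OF G p] adjacency_star_cone mat_id_def
    have [simp]: "0 < p" using p by simp
    consider (center) "i = Inl 0" | (leaf) l where "i = Inl l" "l < p" "l \<noteq> 0"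
      | (vert) v where "i = Inr (Inl v)" "v \<in> ?V"
      using i by (auto simp: pverts_star_cone[OF p])
    note i_cases = this
    consider (inl) l where "j = Inl l" "l < p" | (inr) w where "j = Inr (Inl w)" "w \<in> ?V"
      using j by (auto simp: pverts_star_cone[OF p])
    note j_cases = this
    from i_cases show ?thesis
    proof cases
      case center
      from j_cases show ?thesis
      proof cases
        case inl
        \<comment> \<open>Only the leaf \<open>l\<close> has a nonzero potential and sends a unit
          current into the centre; for \<open>l = 0\<close> all potentials vanish.\<close>
        have "(\<Sum>k\<in>{1..<p}. - (if k = l \<and> k \<noteq> 0 then 1 else 0 :: real)) =
            (if l = 0 then 0 else -1)"
          using inl by (cases "l = 0") (auto simp: sum_negf)
        with inl show ?thesis
          by (simp add: center s)
      next
        case inr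
        then show ?thesis by (simp add: center s sum_negf colsum)
      qed
    next
      case leaf
      from j_cases leaf show ?thesis by cases (simp_all add: s)
    next
      case vert
      from j_cases show ?thesis
      proof cases
        case inl
        with vert show ?thesis by (simp add: s)
      next
        case inr
        with vert show ?thesis
          using LM[of v w] laplacian_apply[OF G, of v "\<lambda>k. M k w"] by (simp add: s)
      qed
    qed
  qed
  then show ?thesis
    by (simp add: mat_eq_def mat_mul_def laplacian_apply[OF pair_graph_star_cone[OF G p]])
qed

section \<open>The five resistance distances\<close>

theorem theorem3p3:
  fixes G :: "'a pair_pre_digraph" and n p :: nat
    and M :: "'a \<Rightarrow> 'a \<Rightarrow> real"
    and H :: "(nat + ('a + unit)) pair_pre_digraph"
    and ustar :: "nat + ('a + unit)"
  assumes "pair_graph G" and "card (pverts G) = n" and "p \<ge> 2"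
    and "M = mat_inverse (pverts G) (mat_add (laplacian G) mat_id)"
    and "H = coalescence (star_graph p) 0 (graph_join G K1) (Inr ())"
    and "ustar = Inl 0"
  shows "(\<forall>l \<in> pverts (star_graph p) - {0}. resistance H ustar (Inl l) = 1) \<and>
    (\<forall>j \<in> pverts G. resistance H ustar (Inr (Inl j)) = M j j) \<and>
    (\<forall>k \<in> pverts (star_graph p) - {0}. \<forall>l \<in> pverts (star_graph p) - {0}.
       k \<noteq> l \<longrightarrow> resistance H (Inl k) (Inl l) = 2) \<and>
    (\<forall>l \<in> pverts (star_graph p) - {0}. \<forall>j \<in> pverts G.
       resistance H (Inl l) (Inr (Inl j)) = 1 + M j j) \<and>
    (\<forall>i \<in> pverts G. \<forall>j \<in> pverts G. i \<noteq> j \<longrightarrow>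
       resistance H (Inr (Inl i)) (Inr (Inl j)) = M i i + M j j - 2 * M i j)"
proof -
  have p: "p \<ge> 1" using assms(3) by simp
  have H: "H = star_cone p G" by (simp add: assms(5) star_cone_def)
  have A_sym: "mat_add (laplacian G) mat_id i j = mat_add (laplacian G) mat_id j i" for i j
    using laplacian_sym[OF assms(1)] by (simp add: mat_add_def mat_id_def)
  note inv = pos_def_on_inverse[OF pair_graph_finite_verts[OF assms(1)] A_sym
      pos_def_laplacian_plus_id[OF assms(1)], folded assms(4)]
  have "mat_eq (pverts G) (mat_mul (pverts G) (mat_add (laplacian G) mat_id) M) mat_id"
    using inv(1) by (simp add: is_mat_inverse_def)
  note LY = laplacian_star_cone_potential[OF assms(1) p this]
  have u: "Inl 0 \<in> pverts (star_cone p G)"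
    using p by (simp add: pverts_star_cone)
  note res = resistance_grounded[OF pair_graph_star_cone[OF assms(1) p] u
      star_cone_potential_sym[OF inv(2)] LY]
  \<comment> \<open>Each case reads off entries of the potential matrix: the diagonal is 0 at the
    centre, 1 at leaves and \<open>M j j\<close> on \<open>G\<close>; off the diagonal only the
    entries \<open>M i j\<close> within \<open>G\<close> can be nonzero.\<close>
  show ?thesis
    using p by (auto simp: H assms(6) res pverts_star_cone[OF p] star_graph_def)
qed

end
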